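(* Let $\mathbf{F}_2$ be the free group on the two generators $a,b$. For each of the following words $w_i\in\mathbf{F}_2$, the word map $w_i: SL(2,\mathbb{C})\times SL(2,\mathbb{C})\to SL(2,\mathbb{C})$, $(x,y)\mapsto w_i(x,y)$, is surjective: $w_{1}(a,b)=[[a,b],\,a[a,b]a^{-1}]$; $w_{2}(a,b)=[[a,b],\,b[a,b]b^{-1}]$; $w_{3}(a,b)=[[a,b],\,(ab)[a,b](ab)^{-1}]$; $w_{4}(a,b)=[[a,b],\,ab^{2}[a,b]b^{-2}a^{-1}]$; $w_{5}(a,b)=[[a,b],\,a]$.
   Context: For a group $G$ and a word $w=w(a,b)\in\mathbf{F}_2$, the word map associated with $w$ is the map $w:G\times G\to G$ sending $(x,y)$ to the element $w(x,y)$ obtained by substituting $x$ for $a$ and $y$ for $b$. The commutator convention is $[u,v]=uvu^{-1}v^{-1}$. $SL(2,\mathbb{C})$ is the group of $2\times 2$ complex matrices of determinant $1$. *)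

theory Defs
  imports "HOL-Algebra.Group" "HOL-Analysis.Determinants"
begin

section \<open>The free group on two generators\<close>

datatype generator = GenA | GenB

text \<open>The letter \<open>(g, True)\<close> stands for \<open>g\<close> and \<open>(g, False)\<close> for its formal inverse.\<close>

type_synonym letter = "generator \<times> bool"

definition inv_letter :: "letter \<Rightarrow> letter" where
  "inv_letter l = (fst l, \<not> snd l)"

text \<open>Elements of the free group are the freely reduced lists of letters.\<close>

definition reduced :: "letter list \<Rightarrow> bool" where
  "reduced w \<longleftrightarrow> successively (\<lambda>l m. m \<noteq> inv_letter l) w"

fun cons_reduce :: "letter \<Rightarrow> letter list \<Rightarrow> letter list" where
  "cons_reduce l [] = [l]"
| "cons_reduce l (m # w) = (if m = inv_letter l then w else l # m # w)"

definition F2 :: "letter list monoid" where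
  "F2 = \<lparr>carrier = {w. reduced w}, monoid.mult = foldr cons_reduce, one = []\<rparr>"

definition gen_a :: "letter list" where
  "gen_a = [(GenA, True)]"

definition gen_b :: "letter list" where
  "gen_b = [(GenB, True)]"

lemma inv_letter_inv_letter [simp]: "inv_letter (inv_letter l) = l"
  by (simp add: inv_letter_def)

lemma inv_letter_neq [simp]: "inv_letter l \<noteq> l" "l \<noteq> inv_letter l"
  by (cases l; simp add: inv_letter_def)+

lemma reduced_Nil [simp]: "reduced []"
  by (simp add: reduced_def)

lemma reduced_ConsD: "reduced (l # w) \<Longrightarrow> reduced w"
  by (cases w) (auto simp: reduced_def)

lemma reduced_cons_reduce: "reduced w \<Longrightarrow> reduced (cons_reduce l w)"
  by (cases w) (auto simp: reduced_def successively_Cons)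

lemma reduced_foldr: "reduced w \<Longrightarrow> reduced (foldr cons_reduce u w)"
  by (induction u) (auto intro: reduced_cons_reduce)

lemma cons_reduce_cancel:
  "reduced w \<Longrightarrow> cons_reduce l (cons_reduce (inv_letter l) w) = w"
  by (cases w rule: remdups_adj.cases) (auto simp: reduced_def)

lemma cons_reduce_reduced: "reduced (l # w) \<Longrightarrow> cons_reduce l w = l # w"
  by (cases w) (auto simp: reduced_def)

lemma foldr_cons_reduce_Nil: "reduced w \<Longrightarrow> foldr cons_reduce w [] = w"
proof (induction w)
  case (Cons l w)
  then show ?case
    using reduced_ConsD[OF Cons.prems] by (simp add: cons_reduce_reduced)
qed simp

lemma foldr_cons_reduce:
  assumes "reduced w"
  shows "foldr cons_reduce (cons_reduce l u) w = cons_reduce l (foldr cons_reduce u w)"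
  using cons_reduce_cancel[OF reduced_foldr[OF assms], of l]
  by (cases u) auto

lemma foldr_cons_reduce_assoc:
  "reduced w \<Longrightarrow> foldr cons_reduce (foldr cons_reduce u v) w =
     foldr cons_reduce u (foldr cons_reduce v w)"
  by (induction u) (auto simp: foldr_cons_reduce)

lemma foldr_cons_reduce_rev:
  "reduced v \<Longrightarrow> foldr cons_reduce (rev (map inv_letter u)) (foldr cons_reduce u v) = v"
proof (induction u arbitrary: v)
  case (Cons l u)
  then show ?case
    using cons_reduce_cancel[OF reduced_foldr[OF Cons.prems], of "inv_letter l" u] by simp
qed simp

lemma group_F2: "group F2"
proof (rule groupI)
  fix u assume "u \<in> carrier F2"
  then have "reduced u" by (simp add: F2_def)
  let ?v = "foldr cons_reduce (rev (map inv_letter u)) []"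
  have "?v \<in> carrier F2"
    by (simp add: F2_def reduced_foldr)
  moreover have "?v \<otimes>\<^bsub>F2\<^esub> u = \<one>\<^bsub>F2\<^esub>"
    using foldr_cons_reduce_rev[of "[]" u] \<open>reduced u\<close>
    by (simp add: F2_def foldr_cons_reduce_assoc foldr_cons_reduce_Nil)
  ultimately show "\<exists>v\<in>carrier F2. v \<otimes>\<^bsub>F2\<^esub> u = \<one>\<^bsub>F2\<^esub>" by blast
qed (auto simp: F2_def reduced_foldr foldr_cons_reduce_assoc)

lemma gen_closed [simp]: "gen_a \<in> carrier F2" "gen_b \<in> carrier F2"
  by (simp_all add: gen_a_def gen_b_def F2_def reduced_def)


section \<open>Word maps\<close>

fun letter_value :: "('g, 'm) monoid_scheme \<Rightarrow> 'g \<Rightarrow> 'g \<Rightarrow> letter \<Rightarrow> 'g" where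
  "letter_value G x y (g, s) =
     (let z = (case g of GenA \<Rightarrow> x | GenB \<Rightarrow> y) in if s then z else inv\<^bsub>G\<^esub> z)"

definition word_map :: "('g, 'm) monoid_scheme \<Rightarrow> letter list \<Rightarrow> 'g \<times> 'g \<Rightarrow> 'g" where
  "word_map G w = (\<lambda>(x, y). foldr (\<lambda>l z. letter_value G x y l \<otimes>\<^bsub>G\<^esub> z) w \<one>\<^bsub>G\<^esub>)"

text \<open>
  For fixed \<open>x\<close> and \<open>y\<close>, evaluation of words is the homomorphism from the free group
  that sends the two generators to \<open>x\<close> and \<open>y\<close>.
\<close>

lemma (in group) word_map_hom:
  assumes "x \<in> carrier G" "y \<in> carrier G"
  shows "(\<lambda>w. word_map G w (x, y)) \<in> hom F2 G"
proof -
  let ?v = "letter_value G x y" and ?e = "\<lambda>w. word_map G w (x, y)"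
  have v: "?v l \<in> carrier G" for l
    using assms by (cases l) (auto simp: Let_def split: generator.splits)
  have Nil: "?e [] = \<one>" and Cons: "?e (l # w) = ?v l \<otimes> ?e w" for l w
    by (simp_all add: word_map_def)
  have e: "?e w \<in> carrier G" for w
    by (induction w) (simp_all add: Nil Cons v)
  have inv: "?v (inv_letter l) = inv (?v l)" for l
    using assms by (cases l) (auto simp: inv_letter_def Let_def split: generator.splits)
  have cancel: "?v l \<otimes> (inv (?v l) \<otimes> z) = z" if "z \<in> carrier G" for l z
    using that v by (simp flip: m_assoc)
  have cr: "?e (cons_reduce l w) = ?v l \<otimes> ?e w" for l w
    by (cases w) (auto simp: Nil Cons inv cancel e v)
  have "?e (foldr cons_reduce u w) = ?e u \<otimes> ?e w" for u w
    by (induction u) (simp_all add: Nil Cons cr e v m_assoc)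
  then show ?thesis
    by (auto simp: hom_def F2_def e)
qed

lemma (in group) word_map_gen:
  assumes "x \<in> carrier G" "y \<in> carrier G"
  shows "word_map G gen_a (x, y) = x" "word_map G gen_b (x, y) = y"
  using assms by (simp_all add: word_map_def gen_a_def gen_b_def)


section \<open>The special linear group\<close>

definition SL2C :: "(complex^2^2) monoid" where
  "SL2C = \<lparr>carrier = {A. det A = 1}, monoid.mult = (**), one = mat 1\<rparr>"

lemma group_SL2C: "group SL2C"
proof (rule groupI)
  fix A assume "A \<in> carrier SL2C"
  then have A: "det A = 1" by (simp add: SL2C_def)
  then obtain B where B: "A ** B = mat 1" "B ** A = mat 1"
    by (metis invertible_def invertible_det_nz zero_neq_one)
  then have "det B = 1"
    using A by (metis det_I det_mul mult_1)
  with B show "\<exists>B\<in>carrier SL2C. B \<otimes>\<^bsub>SL2C\<^esub> A = \<one>\<^bsub>SL2C\<^esub>"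
    by (auto simp: SL2C_def)
qed (auto simp: SL2C_def det_mul matrix_mul_assoc)


section \<open>The words\<close>

definition commutator :: "('g, 'm) monoid_scheme \<Rightarrow> 'g \<Rightarrow> 'g \<Rightarrow> 'g" where
  "commutator G u v = u \<otimes>\<^bsub>G\<^esub> v \<otimes>\<^bsub>G\<^esub> inv\<^bsub>G\<^esub> u \<otimes>\<^bsub>G\<^esub> inv\<^bsub>G\<^esub> v"

definition w1 :: "letter list" where
  "w1 = (let a = gen_a; c = commutator F2 gen_a gen_b in
     commutator F2 c (a \<otimes>\<^bsub>F2\<^esub> c \<otimes>\<^bsub>F2\<^esub> inv\<^bsub>F2\<^esub> a))"

definition w2 :: "letter list" where
  "w2 = (let b = gen_b; c = commutator F2 gen_a gen_b in
     commutator F2 c (b \<otimes>\<^bsub>F2\<^esub> c \<otimes>\<^bsub>F2\<^esub> inv\<^bsub>F2\<^esub> b))"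

definition w3 :: "letter list" where
  "w3 = (let a = gen_a; b = gen_b; c = commutator F2 a b in
     commutator F2 c ((a \<otimes>\<^bsub>F2\<^esub> b) \<otimes>\<^bsub>F2\<^esub> c \<otimes>\<^bsub>F2\<^esub> inv\<^bsub>F2\<^esub> (a \<otimes>\<^bsub>F2\<^esub> b)))"

definition w4 :: "letter list" where
  "w4 = (let a = gen_a; b = gen_b; c = commutator F2 a b in
     commutator F2 c
       (a \<otimes>\<^bsub>F2\<^esub> b [^]\<^bsub>F2\<^esub> (2::int) \<otimes>\<^bsub>F2\<^esub> c \<otimes>\<^bsub>F2\<^esub> b [^]\<^bsub>F2\<^esub> (-2::int) \<otimes>\<^bsub>F2\<^esub> inv\<^bsub>F2\<^esub> a))"

definition w5 :: "letter list" where
  "w5 = commutator F2 (commutator F2 gen_a gen_b) gen_a"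

end

theory Submission
  imports Defs
begin

text \<open>
  Everything reduces to the word \<open>w1\<close>. Write \<open>c = [a, b]\<close>. In any group,
  \<open>w3(a, b) = w1(a b, a\<^sup>-\<^sup>1)\<close> and \<open>w4(a, b) = w3(a b, b)\<close>, while
  \<open>w2(a, b)\<close> is conjugate to \<open>w1(b, a)\<close> and \<open>w1(a, b)\<close> is conjugate to
  \<open>w5(c\<^sup>-\<^sup>1, a)\<close>. The values of a word map are closed under conjugation, so each of
  the other four words takes every value of \<open>w1\<close>.

  For \<open>w1\<close>, the variable \<open>b\<close> can be eliminated: an equation \<open>c = [a, b]\<close> says that
  \<open>b\<close> conjugates \<open>a\<^sup>-\<^sup>1\<close> to \<open>a\<^sup>-\<^sup>1 c\<close>. Two matrices of determinant one that are not
  scalar are conjugate in the special linear group as soon as their traces agree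
  (\<open>conjugate_if_trace_eq\<close>). Hence any \<open>a\<close> and \<open>c\<close> with \<open>tr (a\<^sup>-\<^sup>1 c) = tr a\<close>, both
  \<open>a\<close> and \<open>a\<^sup>-\<^sup>1 c\<close> not scalar, give the value \<open>[c, a c a\<^sup>-\<^sup>1]\<close> of \<open>w1\<close>. Taking for \<open>c\<close> the
  companion matrix of trace \<open>s\<close> and \<open>a\<close> lower triangular with diagonal \<open>x, 1 / x\<close>, the
  trace condition just fixes the remaining entry of \<open>a\<close> (\<open>w1_image_witness\<close>).

  With \<open>s = 1\<close> the value has trace \<open>q\<^sup>2 + q\<close>, where \<open>q = x\<^sup>2 + 1 / x\<^sup>2\<close>, and it is not
  scalar when \<open>q \<noteq> -2\<close>. Since \<open>q\<close> is arbitrary and \<open>q\<^sup>2 + q = t\<close> always has a root other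
  than \<open>-2\<close>, this reaches a nonscalar matrix of every trace \<open>t\<close>, the unipotent matrices and
  their negatives included, and thus every nonscalar matrix. The scalar matrix \<open>1\<close> is a
  trivial value, and \<open>-1\<close> is reached with \<open>s = 0\<close> and \<open>x\<close> a primitive sixth root of unity.
\<close>


section \<open>Identities between the words\<close>

lemma (in group) mult_inv_cancel:
  assumes "x \<in> carrier G" "y \<in> carrier G"
  shows "x \<otimes> (inv x \<otimes> y) = y" "inv x \<otimes> (x \<otimes> y) = y"
  using assms by (simp_all flip: m_assoc)

lemma (in group) commutator_closed [simp]:
  "x \<in> carrier G \<Longrightarrow> y \<in> carrier G \<Longrightarrow> commutator G x y \<in> carrier G"
  by (simp add: commutator_def)

lemma (in group_hom) hom_commutator:
  "x \<in> carrier G \<Longrightarrow> y \<in> carrier G \<Longrightarrow> h (commutator G x y) = commutator H (h x) (h y)"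
  by (simp add: commutator_def)

text \<open>
  Evaluation at \<open>(x, y)\<close> is a homomorphism from the free group, so it can be pushed through the
  expressions that define the words; their reduced forms are never computed.
\<close>

lemma (in group) word_map_words:
  assumes "x \<in> carrier G" "y \<in> carrier G"
  defines "c \<equiv> commutator G x y"
  shows "word_map G w1 (x, y) = commutator G c (x \<otimes> c \<otimes> inv x)"
    and "word_map G w2 (x, y) = commutator G c (y \<otimes> c \<otimes> inv y)"
    and "word_map G w3 (x, y) = commutator G c (x \<otimes> y \<otimes> c \<otimes> inv (x \<otimes> y))"
    and "word_map G w4 (x, y) =
      commutator G c (x \<otimes> (y \<otimes> y) \<otimes> c \<otimes> inv (y \<otimes> y) \<otimes> inv x)"
    and "word_map G w5 (x, y) = commutator G c x"
proof -
  interpret F2: group F2 by (rule group_F2)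
  interpret group_hom F2 G "\<lambda>w. word_map G w (x, y)"
    by (intro group_hom.intro group_hom_axioms.intro group_F2 is_group word_map_hom assms)
  have pow: "y [^] (2::int) = y \<otimes> y" "y [^] (- 2::int) = inv (y \<otimes> y)"
    using assms int_pow_int[of G y 2] by (simp_all add: int_pow_neg numeral_2_eq_2)
  show "word_map G w1 (x, y) = commutator G c (x \<otimes> c \<otimes> inv x)"
    "word_map G w2 (x, y) = commutator G c (y \<otimes> c \<otimes> inv y)"
    "word_map G w3 (x, y) = commutator G c (x \<otimes> y \<otimes> c \<otimes> inv (x \<otimes> y))"
    "word_map G w4 (x, y) =
      commutator G c (x \<otimes> (y \<otimes> y) \<otimes> c \<otimes> inv (y \<otimes> y) \<otimes> inv x)"
    "word_map G w5 (x, y) = commutator G c x"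
    by (simp_all only: w1_def w2_def w3_def w4_def w5_def c_def Let_def hom_commutator hom_mult
        hom_inv hom_int_pow word_map_gen[OF assms(1,2)] pow gen_closed F2.m_closed
        F2.inv_closed F2.int_pow_closed F2.commutator_closed)
qed

lemma (in group) letter_value_closed:
  assumes "x \<in> carrier G" "y \<in> carrier G"
  shows "letter_value G x y l \<in> carrier G"
  using assms by (cases l) (auto simp: Let_def split: generator.splits)

lemma (in group) word_map_closed:
  assumes "x \<in> carrier G" "y \<in> carrier G"
  shows "word_map G w (x, y) \<in> carrier G"
  using letter_value_closed[OF assms] by (induction w) (simp_all add: word_map_def assms)

lemma (in group) word_map_conjugate:
  assumes "x \<in> carrier G" "y \<in> carrier G" "h \<in> carrier G"
  shows "word_map G w (h \<otimes> x \<otimes> inv h, h \<otimes> y \<otimes> inv h) = h \<otimes> word_map G w (x, y) \<otimes> inv h"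
proof -
  have letter: "letter_value G (h \<otimes> x \<otimes> inv h) (h \<otimes> y \<otimes> inv h) l =
      h \<otimes> letter_value G x y l \<otimes> inv h" for l
    using assms by (cases l) (auto simp: Let_def inv_mult_group m_assoc split: generator.splits)
  show ?thesis
  proof (induction w)
    case Nil
    then show ?case using assms by (simp add: word_map_def)
  next
    case (Cons l w)
    have "word_map G (l # w) (u, v) = letter_value G u v l \<otimes> word_map G w (u, v)" for u v
      by (simp add: word_map_def)
    then show ?case
      using assms by (simp only: Cons.IH letter) (simp add: letter_value_closed word_map_closed m_assoc mult_inv_cancel)
  qed
qed

lemma (in group) conjugate_in_word_image:
  assumes "g \<in> word_map G w ` (carrier G \<times> carrier G)" "h \<in> carrier G"
  shows "h \<otimes> g \<otimes> inv h \<in> word_map G w ` (carrier G \<times> carrier G)"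
proof -
  obtain x y where xy: "x \<in> carrier G" "y \<in> carrier G" "g = word_map G w (x, y)"
    using assms(1) by auto
  with assms(2) have "h \<otimes> g \<otimes> inv h = word_map G w (h \<otimes> x \<otimes> inv h, h \<otimes> y \<otimes> inv h)"
    by (simp add: word_map_conjugate)
  then show ?thesis
    using xy assms(2) by (intro image_eqI) auto
qed

text \<open>
  Exchanging the two variables inverts \<open>c\<close>, and
  \<open>[c\<^sup>-\<^sup>1, d\<^sup>-\<^sup>1] = (d c)\<^sup>-\<^sup>1 [c, d] (d c)\<close>.
\<close>

lemma (in group) w1_image_subset_w2:
  "word_map G w1 ` (carrier G \<times> carrier G) \<subseteq> word_map G w2 ` (carrier G \<times> carrier G)"
proof clarify
  fix x y assume xy: "x \<in> carrier G" "y \<in> carrier G"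
  define c where "c = commutator G y x"
  define d where "d = x \<otimes> c \<otimes> inv x"
  have cd: "c \<in> carrier G" "d \<in> carrier G" using xy by (simp_all add: c_def d_def)
  have c': "commutator G x y = inv c"
    using xy by (simp add: c_def commutator_def inv_mult_group m_assoc)
  have "word_map G w1 (x, y) = commutator G (inv c) (inv d)"
    using xy cd by (simp add: word_map_words c' d_def inv_mult_group m_assoc)
  also have "\<dots> = inv (d \<otimes> c) \<otimes> commutator G c d \<otimes> inv (inv (d \<otimes> c))"
    using cd by (simp add: commutator_def inv_mult_group m_assoc mult_inv_cancel)
  also have "commutator G c d = word_map G w2 (y, x)"
    using xy by (simp add: word_map_words c_def d_def)
  finally show "word_map G w1 (x, y) \<in> word_map G w2 ` (carrier G \<times> carrier G)"
    using conjugate_in_word_image[of "word_map G w2 (y, x)" w2 "inv (d \<otimes> c)"] xy cd by auto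
qed

text \<open>
  The substitution \<open>(a, b) \<mapsto> (b\<^sup>-\<^sup>1, b a)\<close> leaves \<open>[a, b]\<close> unchanged and turns the
  product of the two variables into \<open>a\<close>.
\<close>

lemma (in group) w1_image_subset_w3:
  "word_map G w1 ` (carrier G \<times> carrier G) \<subseteq> word_map G w3 ` (carrier G \<times> carrier G)"
proof clarify
  fix x y assume xy: "x \<in> carrier G" "y \<in> carrier G"
  have "commutator G (inv y) (y \<otimes> x) = commutator G x y" and "inv y \<otimes> (y \<otimes> x) = x"
    using xy by (simp_all add: commutator_def inv_mult_group m_assoc mult_inv_cancel)
  then have "word_map G w1 (x, y) = word_map G w3 (inv y, y \<otimes> x)"
    using xy by (simp add: word_map_words)
  then show "word_map G w1 (x, y) \<in> word_map G w3 ` (carrier G \<times> carrier G)"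
    using xy by auto
qed

text \<open>
  The substitution \<open>(a, b) \<mapsto> (a b\<^sup>-\<^sup>1, b)\<close> leaves \<open>[a, b]\<close> unchanged and turns
  \<open>a b\<^sup>2\<close> into \<open>a b\<close>.
\<close>

lemma (in group) w3_image_subset_w4:
  "word_map G w3 ` (carrier G \<times> carrier G) \<subseteq> word_map G w4 ` (carrier G \<times> carrier G)"
proof clarify
  fix x y assume xy: "x \<in> carrier G" "y \<in> carrier G"
  have "commutator G (x \<otimes> inv y) y = commutator G x y"
    using xy by (simp add: commutator_def inv_mult_group m_assoc mult_inv_cancel)
  then have "word_map G w3 (x, y) = word_map G w4 (x \<otimes> inv y, y)"
    using xy by (simp add: word_map_words inv_mult_group m_assoc mult_inv_cancel)
  then show "word_map G w3 (x, y) \<in> word_map G w4 ` (carrier G \<times> carrier G)"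
    using xy by auto
qed

text \<open>
  With \<open>d = a c a\<^sup>-\<^sup>1\<close>, the commutator \<open>[c\<^sup>-\<^sup>1, a]\<close> is \<open>c\<^sup>-\<^sup>1 d\<close>. Therefore
  \<open>[[c\<^sup>-\<^sup>1, a], c\<^sup>-\<^sup>1] = c\<^sup>-\<^sup>1 [d, c\<^sup>-\<^sup>1] c\<close>, and this is conjugate to
  \<open>[c, d] = c [d, c\<^sup>-\<^sup>1] c\<^sup>-\<^sup>1\<close>.
\<close>

lemma (in group) w1_image_subset_w5:
  "word_map G w1 ` (carrier G \<times> carrier G) \<subseteq> word_map G w5 ` (carrier G \<times> carrier G)"
proof clarify
  fix x y assume xy: "x \<in> carrier G" "y \<in> carrier G"
  define c where "c = commutator G x y"
  have c: "c \<in> carrier G" using xy by (simp add: c_def)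
  have "word_map G w1 (x, y) = (c \<otimes> c) \<otimes> word_map G w5 (inv c, x) \<otimes> inv (c \<otimes> c)"
    using xy c by (simp add: word_map_words c_def[symmetric])
      (simp add: commutator_def inv_mult_group m_assoc mult_inv_cancel)
  then show "word_map G w1 (x, y) \<in> word_map G w5 ` (carrier G \<times> carrier G)"
    using conjugate_in_word_image[of "word_map G w5 (inv c, x)" w5 "c \<otimes> c"] xy c by auto
qed


section \<open>Matrices of determinant one\<close>

definition mat2 :: "complex \<Rightarrow> complex \<Rightarrow> complex \<Rightarrow> complex \<Rightarrow> complex^2^2" where
  "mat2 a b c d = vector [vector [a, b], vector [c, d]]"

lemma mat2_eq_iff [simp]:
  "mat2 a b c d = mat2 a' b' c' d' \<longleftrightarrow> a = a' \<and> b = b' \<and> c = c' \<and> d = d'"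
  by (simp add: mat2_def vec_eq_iff forall_2)

lemma mat2_cases: obtains a b c d where "A = mat2 a b c d"
proof
  show "A = mat2 (A$1$1) (A$1$2) (A$2$1) (A$2$2)"
    by (simp add: mat2_def vec_eq_iff forall_2)
qed

lemma mat2_mult:
  "mat2 a b c d ** mat2 a' b' c' d' =
     mat2 (a * a' + b * c') (a * b' + b * d') (c * a' + d * c') (c * b' + d * d')"
  by (simp add: mat2_def matrix_matrix_mult_def vec_eq_iff forall_2 sum_2)

lemma mat2_one: "mat 1 = mat2 1 0 0 1"
  by (simp add: mat2_def mat_def vec_eq_iff forall_2)

lemma mat2_in_SL2C: "mat2 a b c d \<in> carrier SL2C \<longleftrightarrow> a * d - b * c = 1"
  by (simp add: SL2C_def mat2_def det_2)

lemma SL2C_simps: "A \<otimes>\<^bsub>SL2C\<^esub> B = A ** B" "\<one>\<^bsub>SL2C\<^esub> = mat 1"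
  by (simp_all add: SL2C_def)

interpretation SL2C: group SL2C
  by (rule group_SL2C)

lemma inv_mat2:
  assumes "a * d - b * c = 1"
  shows "inv\<^bsub>SL2C\<^esub> (mat2 a b c d) = mat2 d (- b) (- c) a"
  using assms
  by (intro SL2C.inv_equality) (auto simp: SL2C_simps mat2_mult mat2_one mat2_in_SL2C algebra_simps)

text \<open>
  A nonscalar matrix \<open>A\<close> has a cyclic vector \<open>u\<close>. In the basis \<open>u, A u\<close> it becomes
  its companion matrix, by the Cayley-Hamilton theorem. Rescaling \<open>u\<close> by a complex square
  root makes the determinant of the change of basis equal to one, so that the conjugation
  takes place inside the special linear group.
\<close>

lemma conjugate_companion:
  assumes det: "a * d - b * c = 1" and nonscalar: "b \<noteq> 0 \<or> c \<noteq> 0 \<or> a \<noteq> d"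
  obtains P where "P \<in> carrier SL2C" "mat2 a b c d = P \<otimes>\<^bsub>SL2C\<^esub> mat2 0 (-1) 1 (a + d) \<otimes>\<^bsub>SL2C\<^esub> inv\<^bsub>SL2C\<^esub> P"
proof -
  \<comment> \<open>The determinant of the columns \<open>u\<close> and \<open>A u\<close>, for \<open>u = (p, q)\<close>.\<close>
  define Q where "Q p q = c * p\<^sup>2 + (d - a) * p * q - b * q\<^sup>2" for p q
  have "\<exists>p q. Q p q \<noteq> 0"
  proof (rule ccontr)
    assume "\<not> ?thesis"
    then have "Q 1 0 = 0" "Q 0 1 = 0" "Q 1 1 = 0" by auto
    with nonscalar show False by (auto simp: Q_def)
  qed
  then obtain p' q' where nz: "Q p' q' \<noteq> 0" by blast
  define r where "r = csqrt (1 / Q p' q')"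
  define p q where "p = r * p'" and "q = r * q'"
  have "Q p q = r\<^sup>2 * Q p' q'"
    by (simp add: Q_def p_def q_def power2_eq_square algebra_simps)
  with nz have 1: "Q p q = 1" by (simp add: r_def)
  define P where "P = mat2 p (a * p + b * q) q (c * p + d * q)"
  have P: "P \<in> carrier SL2C"
    using 1 by (simp add: P_def mat2_in_SL2C Q_def power2_eq_square algebra_simps)
  have "mat2 a b c d \<otimes>\<^bsub>SL2C\<^esub> P = P \<otimes>\<^bsub>SL2C\<^esub> mat2 0 (-1) 1 (a + d)"
    unfolding P_def SL2C_simps mat2_mult mat2_eq_iff
    using det by (intro conjI) algebra+
  then have "mat2 a b c d = P \<otimes>\<^bsub>SL2C\<^esub> mat2 0 (-1) 1 (a + d) \<otimes>\<^bsub>SL2C\<^esub> inv\<^bsub>SL2C\<^esub> P"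
    using P det by (simp add: SL2C.inv_solve_right mat2_in_SL2C)
  with P show ?thesis by (rule that)
qed

lemma conjugate_if_trace_eq:
  assumes "a * d - b * c = 1" "b \<noteq> 0 \<or> c \<noteq> 0 \<or> a \<noteq> d"
    and "a' * d' - b' * c' = 1" "b' \<noteq> 0 \<or> c' \<noteq> 0 \<or> a' \<noteq> d'"
    and "a + d = a' + d'"
  obtains P where "P \<in> carrier SL2C"
    "mat2 a b c d = P \<otimes>\<^bsub>SL2C\<^esub> mat2 a' b' c' d' \<otimes>\<^bsub>SL2C\<^esub> inv\<^bsub>SL2C\<^esub> P"
proof -
  let ?K = "mat2 0 (-1) 1 (a + d)"
  have K: "?K \<in> carrier SL2C" by (simp add: mat2_in_SL2C)
  obtain P where P: "P \<in> carrier SL2C" "mat2 a b c d = P \<otimes>\<^bsub>SL2C\<^esub> ?K \<otimes>\<^bsub>SL2C\<^esub> inv\<^bsub>SL2C\<^esub> P"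
    using conjugate_companion assms(1,2) by metis
  obtain R where R: "R \<in> carrier SL2C" "mat2 a' b' c' d' = R \<otimes>\<^bsub>SL2C\<^esub> ?K \<otimes>\<^bsub>SL2C\<^esub> inv\<^bsub>SL2C\<^esub> R"
    using conjugate_companion assms(3-5) by metis
  show ?thesis
  proof
    show "P \<otimes>\<^bsub>SL2C\<^esub> inv\<^bsub>SL2C\<^esub> R \<in> carrier SL2C" using P R by simp
    show "mat2 a b c d = P \<otimes>\<^bsub>SL2C\<^esub> inv\<^bsub>SL2C\<^esub> R \<otimes>\<^bsub>SL2C\<^esub> mat2 a' b' c' d' \<otimes>\<^bsub>SL2C\<^esub>
        inv\<^bsub>SL2C\<^esub> (P \<otimes>\<^bsub>SL2C\<^esub> inv\<^bsub>SL2C\<^esub> R)"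
      using P R K by (simp add: SL2C.m_assoc SL2C.inv_mult_group SL2C.mult_inv_cancel)
  qed
qed


section \<open>The first word hits every conjugacy class\<close>

text \<open>
  The matrix \<open>a\<^sup>-\<^sup>1 c\<close> has trace \<open>z + s x\<close>, so the choice of \<open>z\<close> makes the
  nonscalar matrices \<open>a\<^sup>-\<^sup>1\<close> and \<open>a\<^sup>-\<^sup>1 c\<close> conjugate. Any \<open>b\<close> that conjugates the first
  to the second satisfies \<open>[a, b] = c\<close>.
\<close>

lemma w1_image_witness:
  assumes xv: "x * v = 1" and z: "z = x + v - s * x" "z \<noteq> 0"
  defines "a \<equiv> mat2 x 0 z v" and "c \<equiv> mat2 0 (-1) 1 s"
  shows "commutator SL2C c (a \<otimes>\<^bsub>SL2C\<^esub> c \<otimes>\<^bsub>SL2C\<^esub> inv\<^bsub>SL2C\<^esub> a)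
    \<in> word_map SL2C w1 ` (carrier SL2C \<times> carrier SL2C)"
proof -
  have a: "a \<in> carrier SL2C" "inv\<^bsub>SL2C\<^esub> a = mat2 v 0 (- z) x" and c: "c \<in> carrier SL2C"
    using xv by (simp_all add: a_def c_def mat2_in_SL2C inv_mat2 mult.commute)
  have x: "x \<noteq> 0" using xv by auto
  have "inv\<^bsub>SL2C\<^esub> a \<otimes>\<^bsub>SL2C\<^esub> c = mat2 0 (- v) x (x + v)"
    using z by (simp add: a c_def SL2C_simps mat2_mult algebra_simps)
  moreover obtain b where b: "b \<in> carrier SL2C"
    "mat2 0 (- v) x (x + v) = b \<otimes>\<^bsub>SL2C\<^esub> mat2 v 0 (- z) x \<otimes>\<^bsub>SL2C\<^esub> inv\<^bsub>SL2C\<^esub> b"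
    using conjugate_if_trace_eq[of 0 "x + v" "- v" x v x 0 "- z"] xv x z(2)
    by (auto simp: mult.commute add.commute)
  ultimately have "inv\<^bsub>SL2C\<^esub> a \<otimes>\<^bsub>SL2C\<^esub> c = b \<otimes>\<^bsub>SL2C\<^esub> inv\<^bsub>SL2C\<^esub> a \<otimes>\<^bsub>SL2C\<^esub> inv\<^bsub>SL2C\<^esub> b"
    by (simp add: a)
  then have "c = a \<otimes>\<^bsub>SL2C\<^esub> (b \<otimes>\<^bsub>SL2C\<^esub> inv\<^bsub>SL2C\<^esub> a \<otimes>\<^bsub>SL2C\<^esub> inv\<^bsub>SL2C\<^esub> b)"
    using a(1) c SL2C.mult_inv_cancel(1)[of a c] by simp
  then have "c = commutator SL2C a b"
    using a(1) b(1) by (simp add: commutator_def SL2C.m_assoc)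
  then show ?thesis
    using a(1) b(1) SL2C.word_map_words(1)[of a b] by (intro image_eqI[of _ _ "(a, b)"]) auto
qed

text \<open>
  If \<open>tr c = tr d = tr (c d) = 0\<close>, then \<open>c\<close>, \<open>d\<close> and \<open>c d\<close> all square to \<open>-1\<close>, so that
  \<open>[c, d] = (c d)\<^sup>2 = -1\<close>. For \<open>d = a c a\<^sup>-\<^sup>1\<close> with \<open>tr c = 0\<close> and \<open>tr (a\<^sup>-\<^sup>1 c) = tr a\<close>, the
  trace of \<open>c d\<close> is \<open>2 - 2 (tr a)\<^sup>2\<close>; this is why \<open>x\<close> and \<open>v = 1 / x\<close> are chosen with
  sum one.
\<close>

lemma minus_one_in_w1_image:
  "mat2 (-1) 0 0 (-1) \<in> word_map SL2C w1 ` (carrier SL2C \<times> carrier SL2C)"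
proof -
  define x v where "x = (1 + csqrt (-3)) / 2" and "v = (1 - csqrt (-3)) / 2"
  have sq: "csqrt (-3) * csqrt (-3) = -3" by (metis power2_csqrt power2_eq_square)
  have xv: "x * v = 1" "x + v = 1"
    using sq by (simp_all add: x_def v_def field_simps)
  have v: "v = 1 - x" using xv(2) by (simp add: algebra_simps)
  have "x * x = x - 1" using xv(1) by (simp add: v algebra_simps)
  then have sq_x: "x * x = x - 1" "x * (x * y) = x * y - y" for y
    by (simp_all add: left_diff_distrib flip: mult.assoc)
  let ?a = "mat2 x 0 1 v" and ?c = "mat2 0 (-1) 1 0"
  have "?a \<otimes>\<^bsub>SL2C\<^esub> ?c \<otimes>\<^bsub>SL2C\<^esub> inv\<^bsub>SL2C\<^esub> ?a = mat2 x (- x\<^sup>2) v (- x)"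
    by (simp add: inv_mat2 xv(1) SL2C_simps mat2_mult)
      (simp add: v power2_eq_square algebra_simps sq_x)
  moreover have "commutator SL2C ?c (mat2 x (- x\<^sup>2) v (- x)) = mat2 (-1) 0 0 (-1)"
  proof -
    have 1: "x * (- x) - (- x\<^sup>2) * v = 1"
      by (simp add: v power2_eq_square algebra_simps sq_x)
    show ?thesis
      by (simp add: commutator_def inv_mat2[OF 1] inv_mat2[of 0 0 "-1" 1] SL2C_simps mat2_mult)
        (simp add: v power2_eq_square algebra_simps sq_x power4_eq_xxxx)
  qed
  ultimately show ?thesis
    using w1_image_witness[of x v 1 0] xv by simp
qed

text \<open>
  For \<open>s = 1\<close> the value of \<open>w1\<close> is the matrix \<open>?g\<close> below, of trace \<open>q\<^sup>2 + q\<close> for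
  \<open>q = x\<^sup>2 + v\<^sup>2\<close>. Its upper right entry vanishes only for \<open>v\<^sup>2 = -1\<close>, that is, for
  \<open>q = -2\<close>, so \<open>q\<close> must be a root of \<open>q\<^sup>2 + q = a + d\<close> different from \<open>-2\<close>.
\<close>

lemma nonscalar_in_w1_image:
  assumes det: "a * d - b * c = 1" and nonscalar: "b \<noteq> 0 \<or> c \<noteq> 0 \<or> a \<noteq> d"
  shows "mat2 a b c d \<in> word_map SL2C w1 ` (carrier SL2C \<times> carrier SL2C)"
proof -
  define e where "e = csqrt (1 + 4 * (a + d))"
  have e: "e * e = 1 + 4 * (a + d)" unfolding e_def by (metis power2_csqrt power2_eq_square)
  obtain q where q: "q\<^sup>2 + q = a + d" "q \<noteq> -2"
  proof (cases "(e - 1) / 2 = -2")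
    case False
    with e show ?thesis
      by (intro that[of "(e - 1) / 2"]) (auto simp: power2_eq_square field_simps)
  next
    case True
    \<comment> \<open>The roots of \<open>q\<^sup>2 + q = 2\<close> are \<open>-2\<close> and \<open>1\<close>.\<close>
    then have "e = -3" by (simp add: field_simps)
    moreover have "a + d = (e * e - 1) / 4" using e by simp
    ultimately show ?thesis by (intro that[of 1]) simp_all
  qed
  \<comment> \<open>Solving \<open>x\<^sup>2 + 1 / x\<^sup>2 = q\<close>, a quadratic equation for \<open>x\<^sup>2\<close>.\<close>
  define f where "f = csqrt (q\<^sup>2 - 4)"
  define x where "x = csqrt ((q + f) / 2)"
  define v where "v = 1 / x"
  have f: "f * f = q\<^sup>2 - 4" unfolding f_def by (metis power2_csqrt power2_eq_square)
  have x2: "x\<^sup>2 = (q + f) / 2" by (simp add: x_def)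
  have "x\<^sup>2 * x\<^sup>2 - q * x\<^sup>2 + 1 = (f * f - (q\<^sup>2 - 4)) / 4"
    unfolding x2 by (simp add: field_simps power2_eq_square)
  then have eq: "x\<^sup>2 * x\<^sup>2 - q * x\<^sup>2 + 1 = 0"
    by (simp add: f)
  then have x: "x \<noteq> 0" by auto
  then have xv: "x * v = 1" by (simp add: v_def)
  then have vx: "v * x = 1" by (simp add: mult.commute)
  \<comment> \<open>As rewrite rules these decide polynomial identities in \<open>x\<close> and \<open>v\<close> modulo \<open>x v = 1\<close>.\<close>
  have cancel: "v * x = 1" "v * (x * y) = y" "x * (v * y) = y" for y
    using xv vx by (simp_all flip: mult.assoc)
  have "v\<^sup>2 * (x\<^sup>2 * x\<^sup>2 - q * x\<^sup>2 + 1) = x\<^sup>2 - q + v\<^sup>2"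
    by (simp add: power2_eq_square algebra_simps xv cancel)
  with eq have qxv: "q = x\<^sup>2 + v\<^sup>2" by (simp add: algebra_simps)
  have nz: "1 + v\<^sup>2 \<noteq> 0"
  proof
    assume "1 + v\<^sup>2 = 0"
    then have v2: "v\<^sup>2 = -1" by (simp add: add_eq_0_iff)
    moreover have "x\<^sup>2 * v\<^sup>2 = 1" using xv by (simp flip: power_mult_distrib)
    ultimately have "x\<^sup>2 = -1" by (simp add: minus_equation_iff)
    with v2 qxv q(2) show False by simp
  qed
  let ?a = "mat2 x 0 v v" and ?c = "mat2 0 (-1) 1 1"
  let ?g = "mat2 (v^4) (- 1 - v\<^sup>2) (- v\<^sup>2 * (1 + v\<^sup>2)) (2 + v\<^sup>2 + x\<^sup>2 + x^4)"
  have "?a \<otimes>\<^bsub>SL2C\<^esub> ?c \<otimes>\<^bsub>SL2C\<^esub> inv\<^bsub>SL2C\<^esub> ?a = mat2 1 (- x\<^sup>2) (v\<^sup>2) 0"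
    by (simp add: inv_mat2 xv SL2C_simps mat2_mult)
      (simp add: power2_eq_square algebra_simps xv cancel)
  moreover have "commutator SL2C ?c (mat2 1 (- x\<^sup>2) (v\<^sup>2) 0) = ?g"
  proof -
    have 1: "1 * 0 - (- x\<^sup>2) * v\<^sup>2 = 1"
      by (simp add: power2_eq_square algebra_simps xv cancel)
    show ?thesis
      by (simp add: commutator_def inv_mat2[OF 1] inv_mat2[of 0 1 "-1" 1] SL2C_simps mat2_mult)
        (simp add: power2_eq_square power4_eq_xxxx algebra_simps xv cancel)
  qed
  ultimately have g: "?g \<in> word_map SL2C w1 ` (carrier SL2C \<times> carrier SL2C)"
    using w1_image_witness[of x v v 1] xv by (cases "v = 0") simp_all
  have det_g: "v^4 * (2 + v\<^sup>2 + x\<^sup>2 + x^4) - (- 1 - v\<^sup>2) * (- v\<^sup>2 * (1 + v\<^sup>2)) = 1"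
    by (simp add: power2_eq_square power4_eq_xxxx algebra_simps xv cancel)
  have off_diagonal: "- 1 - v\<^sup>2 \<noteq> 0"
    using nz by (simp add: algebra_simps add_eq_0_iff)
  have trace_g: "a + d = v^4 + (2 + v\<^sup>2 + x\<^sup>2 + x^4)"
    unfolding q(1)[symmetric] qxv
    by (simp add: power2_eq_square power4_eq_xxxx algebra_simps xv cancel)
  obtain P where "P \<in> carrier SL2C" "mat2 a b c d = P \<otimes>\<^bsub>SL2C\<^esub> ?g \<otimes>\<^bsub>SL2C\<^esub> inv\<^bsub>SL2C\<^esub> P"
    using conjugate_if_trace_eq[OF det nonscalar det_g _ trace_g] off_diagonal by metis
  then show ?thesis
    using SL2C.conjugate_in_word_image[OF g] by metis
qed

lemma w1_surjective:
  "carrier SL2C \<subseteq> word_map SL2C w1 ` (carrier SL2C \<times> carrier SL2C)"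
proof
  fix A assume "A \<in> carrier SL2C"
  moreover obtain a b c d where A: "A = mat2 a b c d" by (rule mat2_cases)
  ultimately have det: "a * d - b * c = 1" by (simp add: mat2_in_SL2C)
  show "A \<in> word_map SL2C w1 ` (carrier SL2C \<times> carrier SL2C)"
  proof (cases "b = 0 \<and> c = 0 \<and> a = d")
    case False
    then show ?thesis using nonscalar_in_w1_image[OF det] A by auto
  next
    case True
    with det have "a\<^sup>2 = 1" by (simp add: power2_eq_square)
    then consider "a = 1" | "a = -1" by (auto simp: power2_eq_1_iff)
    then show ?thesis
    proof cases
      case 1
      have "word_map SL2C w1 (\<one>\<^bsub>SL2C\<^esub>, \<one>\<^bsub>SL2C\<^esub>) = \<one>\<^bsub>SL2C\<^esub>"
        by (simp add: SL2C.word_map_words commutator_def)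
      moreover have "A = \<one>\<^bsub>SL2C\<^esub>" using True 1 A by (simp add: SL2C_simps mat2_one)
      ultimately show ?thesis
        by (intro image_eqI[of _ _ "(\<one>\<^bsub>SL2C\<^esub>, \<one>\<^bsub>SL2C\<^esub>)"]) simp_all
    next
      case 2
      then show ?thesis using True A minus_one_in_w1_image by simp
    qed
  qed
qed

theorem theorem1p3:
  "\<forall>w \<in> {w1, w2, w3, w4, w5}.
     word_map SL2C w ` (carrier SL2C \<times> carrier SL2C) = carrier SL2C"
proof
  fix w assume w: "w \<in> {w1, w2, w3, w4, w5}"
  let ?image = "\<lambda>w. word_map SL2C w ` (carrier SL2C \<times> carrier SL2C)"
  have "?image w1 \<subseteq> ?image w4"
    using SL2C.w1_image_subset_w3 SL2C.w3_image_subset_w4 by (rule order_trans)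
  with w have "?image w1 \<subseteq> ?image w"
    using SL2C.w1_image_subset_w2 SL2C.w1_image_subset_w3 SL2C.w1_image_subset_w5
    by (elim insertE emptyE) simp_all
  moreover have "?image w \<subseteq> carrier SL2C"
    using SL2C.word_map_closed by auto
  ultimately show "?image w = carrier SL2C"
    by (intro equalityI order_trans[OF w1_surjective])
qed

end
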